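(* Let $F:\mathbb{R}^d\to\mathbb{R}$ be differentiable with $\nabla F$ $L$-Lipschitz, and let $x:[0,\infty)\to\mathbb{R}^d$ be a solution of $\ddot{x}(t)+\frac{3}{t}\dot{x}(t)+\nabla F(x(t))=0$ ($t>0$) which has a continuous third derivative on $[0,\infty)$. For each $h>0$ let $(x_n)_{n\ge 0}$ (depending on $h$) be the sequence defined by $x_0=x(0)$, $x_1=x(h)$ and, for $n\ge 1$, $$x_{n+1}=x_n+\frac{n-3}{n}(x_n-x_{n-1})-h^2\,\nabla F\left(x_n+\frac{n-3}{n}(x_n-x_{n-1})\right).$$ Then for every fixed time $t>0$, with $n=t/h$, $x_n$ converges to $x(t)$ at rate $\mathcal{O}(h\ln\frac{1}{h})$ as $h\to 0$; that is, there exist constants $C>0$ and $h_0\in(0,1)$ such that $\|x_{t/h}-x(t)\|\le C\,h\ln\frac{1}{h}$ for all $h\in(0,h_0)$ for which $t/h$ is an integer.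
   Context: The recurrence is Nesterov's accelerated gradient method (NAG) with step size $s=h^2$, i.e. $y_n=x_n+\frac{n-3}{n}(x_n-x_{n-1})$, $x_{n+1}=y_n-s\nabla F(y_n)$ for $n\ge1$. $\|\cdot\|$ is the Euclidean norm. *)

theory Defs
  imports "HOL-Analysis.Analysis"
begin

text \<open>
  Nesterov's accelerated gradient iteration with step size \<open>h\<^sup>2\<close> for the gradient field \<open>g\<close>,
  started from the first two iterates \<open>a\<close> and \<open>b\<close>. In the last equation \<open>n = Suc m\<close> is the
  index of the current iterate, so \<open>n \<ge> 1\<close>; the coefficient \<open>(n - 3) / n\<close> is formed in the
  reals and is negative for \<open>n = 1, 2\<close>.
\<close>

fun nag :: "('a::real_vector \<Rightarrow> 'a) \<Rightarrow> real \<Rightarrow> 'a \<Rightarrow> 'a \<Rightarrow> nat \<Rightarrow> 'a" where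
  "nag g h a b 0 = a"
| "nag g h a b (Suc 0) = b"
| "nag g h a b (Suc (Suc m)) =
     (let n = Suc m;
          y = nag g h a b n + ((real n - 3) / real n) *\<^sub>R (nag g h a b n - nag g h a b m)
      in y - h\<^sup>2 *\<^sub>R g y)"

end

theory Submission
  imports Defs
begin

text \<open>
  The sampled solution \<open>X n = x (n h)\<close> satisfies the iteration up to a residual of norm at most
  \<open>K h\<^sup>2 / n\<close>. The damping coefficient obeys \<open>\<bar>1 - 3/n\<bar> + 1/n \<le> 1\<close> for \<open>n \<ge> 2\<close>, and the first
  error increment vanishes, so these residuals do not accumulate in the increments
  \<open>d n = e n - e (n - 1)\<close> of the error \<open>e\<close>: they stay below \<open>K h\<^sup>2\<close> plus a multiple of \<open>h\<close> times
  the size of the error. A discrete Gronwall argument then gives \<open>e n = O(h)\<close>,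
  which is even better than \<open>O(h ln (1/h))\<close>.
\<close>

section \<open>Mean value and Taylor estimates for vector-valued functions\<close>

lemma vector_mean_value_bound:
  fixes f :: "real \<Rightarrow> 'a::real_normed_vector"
  assumes "convex S"
    and der: "\<And>u. u \<in> S \<Longrightarrow> (f has_vector_derivative f' u) (at u within S)"
    and bound: "\<And>u. u \<in> S \<Longrightarrow> norm (f' u) \<le> B"
    and "s \<in> S" "t \<in> S"
  shows "norm (f s - f t) \<le> B * \<bar>s - t\<bar>"
proof -
  have "norm (f s - f t) \<le> B * norm (s - t)"
  proof (rule differentiable_bound[OF \<open>convex S\<close>])
    show "(f has_derivative (\<lambda>v. v *\<^sub>R f' u)) (at u within S)" if "u \<in> S" for u
      using der[OF that] by (simp add: has_vector_derivative_def)
    show "onorm (\<lambda>v. v *\<^sub>R f' u) \<le> B" if "u \<in> S" for u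
    proof (rule onorm_le)
      show "norm (v *\<^sub>R f' u) \<le> B * norm v" for v
        using mult_right_mono[OF bound[OF that], of "\<bar>v\<bar>"] by (simp add: mult.commute)
    qed
  qed (use assms in auto)
  then show ?thesis by simp
qed

text \<open>The mean value bound is applied three times: to \<open>x''\<close>, to \<open>x'\<close>
  minus its linear part at \<open>t\<close>, and to \<open>x\<close> minus its quadratic part. Each
  pass uses the previous bound uniformly over \<open>S\<close> and so gains one factor
  \<open>h\<close>; the factor 1/6 of the sharp remainder is lost, which affects constants
  only.\<close>

lemma vector_taylor2_bound:
  fixes x x' x'' x''' :: "real \<Rightarrow> 'a::real_normed_vector"
  assumes "convex S"
    and d1: "\<And>u. u \<in> S \<Longrightarrow> (x has_vector_derivative x' u) (at u within S)"
    and d2: "\<And>u. u \<in> S \<Longrightarrow> (x' has_vector_derivative x'' u) (at u within S)"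
    and d3: "\<And>u. u \<in> S \<Longrightarrow> (x'' has_vector_derivative x''' u) (at u within S)"
    and bound: "\<And>u. u \<in> S \<Longrightarrow> norm (x''' u) \<le> B"
    and dist: "\<And>u. u \<in> S \<Longrightarrow> \<bar>u - t\<bar> \<le> h"
    and "s \<in> S" "t \<in> S"
  shows "norm (x s - x t - (s - t) *\<^sub>R x' t - ((s - t)\<^sup>2 / 2) *\<^sub>R x'' t) \<le> B * h ^ 3"
proof -
  have B: "0 \<le> B" using norm_ge_zero bound[OF \<open>t \<in> S\<close>] by (rule order_trans)
  have h: "0 \<le> h" using dist[OF \<open>t \<in> S\<close>] by simp
  have 1: "norm (x'' u - x'' t) \<le> B * h" if "u \<in> S" for u
  proof -
    have "norm (x'' u - x'' t) \<le> B * \<bar>u - t\<bar>"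
      using vector_mean_value_bound[OF \<open>convex S\<close> d3 bound that \<open>t \<in> S\<close>] by simp
    also have "\<dots> \<le> B * h" using dist[OF that] B by (rule mult_left_mono)
    finally show ?thesis .
  qed
  have 2: "norm (x' u - x' t - (u - t) *\<^sub>R x'' t) \<le> B * h * h" if "u \<in> S" for u
  proof -
    define f where "f v = x' v - (v - t) *\<^sub>R x'' t" for v
    have der: "(f has_vector_derivative x'' v - x'' t) (at v within S)" if "v \<in> S" for v
      unfolding f_def by (auto intro!: derivative_eq_intros d2 that)
    have "norm (f u - f t) \<le> B * h * \<bar>u - t\<bar>"
      using vector_mean_value_bound[OF \<open>convex S\<close> der 1 that \<open>t \<in> S\<close>] by simp
    also have "\<dots> \<le> B * h * h"
      using dist[OF that] B h by (intro mult_left_mono) auto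
    finally show ?thesis by (simp add: f_def algebra_simps)
  qed
  define f where "f v = x v - (v - t) *\<^sub>R x' t - ((v - t)\<^sup>2 / 2) *\<^sub>R x'' t" for v
  have der: "(f has_vector_derivative x' v - x' t - (v - t) *\<^sub>R x'' t) (at v within S)"
    if "v \<in> S" for v
    unfolding f_def by (auto intro!: derivative_eq_intros d1 that)
  have "norm (f s - f t) \<le> B * h * h * \<bar>s - t\<bar>"
    using vector_mean_value_bound[OF \<open>convex S\<close> der 2 \<open>s \<in> S\<close> \<open>t \<in> S\<close>] by simp
  also have "\<dots> \<le> B * h * h * h"
    using dist[OF \<open>s \<in> S\<close>] B h by (intro mult_left_mono) auto
  finally show ?thesis by (simp add: f_def algebra_simps power3_eq_cube)
qed

section \<open>Consistency: the residual of the sampled solution\<close>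

text \<open>With \<open>t = m h\<close>, the second difference of \<open>x\<close> matches
  \<open>h^2 x''\<close> up to order \<open>h^3\<close>, and \<open>3/m\<close> times the backward
  difference \<open>p\<close> matches \<open>h^2 (3/t) x'\<close> up to order
  \<open>h^2 / m\<close>, so the differential equation cancels the leading terms. Moving the
  argument of \<open>G\<close> by \<open>c p\<close>, which has order \<open>h\<close>, costs
  another \<open>h^3\<close>.\<close>

lemma nag_residual_bound:
  fixes x x' x'' x''' :: "real \<Rightarrow> 'a::real_normed_vector" and G :: "'a \<Rightarrow> 'a"
  assumes lip: "L-lipschitz_on UNIV G"
    and d1: "\<And>u. u \<in> {0..T} \<Longrightarrow> (x has_vector_derivative x' u) (at u within {0..T})"
    and d2: "\<And>u. u \<in> {0..T} \<Longrightarrow> (x' has_vector_derivative x'' u) (at u within {0..T})"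
    and d3: "\<And>u. u \<in> {0..T} \<Longrightarrow> (x'' has_vector_derivative x''' u) (at u within {0..T})"
    and b1: "\<And>u. u \<in> {0..T} \<Longrightarrow> norm (x' u) \<le> B"
    and b2: "\<And>u. u \<in> {0..T} \<Longrightarrow> norm (x'' u) \<le> B"
    and b3: "\<And>u. u \<in> {0..T} \<Longrightarrow> norm (x''' u) \<le> B"
    and ode: "\<And>t. t > 0 \<Longrightarrow> x'' t + (3 / t) *\<^sub>R x' t + G (x t) = 0"
    and h: "h > 0" and m: "m \<ge> 1" and le: "real (Suc m) * h \<le> T"
  defines "p \<equiv> x (real m * h) - x (real (m - 1) * h)"
  shows "norm (x (real (Suc m) * h) - x (real m * h) - ((real m - 3) / real m) *\<^sub>R p
           + h\<^sup>2 *\<^sub>R G (x (real m * h) + ((real m - 3) / real m) *\<^sub>R p))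
         \<le> B * (2 * L * T + 5 * T + 2) * h\<^sup>2 / real m"
proof -
  define t where "t = real m * h"
  define c where "c = (real m - 3) / real m"
  define q where "q = x (t + h) - x t"
  have mpos: "real m > 0" using m by simp
  have t: "0 < t" "t + h \<le> T" "h \<le> t"
    using h m le by (auto simp: t_def algebra_simps)
  have p: "p = x t - x (t - h)"
    using m by (simp add: p_def t_def of_nat_diff algebra_simps)
  have L: "0 \<le> L" using lip by (rule lipschitz_on_nonneg)
  have B: "0 \<le> B" using b1[of t] t h norm_ge_zero[of "x' t"] by (auto intro: order_trans simp del: norm_ge_zero)
  \<comment> \<open>The extreme value is \<open>c = -2\<close>, attained at
    \<open>m = 1\<close>.\<close>
  have c: "\<bar>c\<bar> \<le> 2" using m by (auto simp: c_def field_simps abs_le_iff)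
  \<comment> \<open>For \<open>m = 1\<close> the left end of \<open>S\<close> is 0, where only
    one-sided derivatives are given; hence all derivatives are taken within sets.\<close>
  define S where "S = {t - h..t + h}"
  have S: "S \<subseteq> {0..T}" using t by (auto simp: S_def)
  have taylor: "norm (x s - x t - (s - t) *\<^sub>R x' t - ((s - t)\<^sup>2 / 2) *\<^sub>R x'' t) \<le> B * h ^ 3"
    if "s \<in> S" for s
  proof (rule vector_taylor2_bound[where S = S and x''' = x'''])
    fix u assume u: "u \<in> S"
    then have u': "u \<in> {0..T}" using S by auto
    show "(x has_vector_derivative x' u) (at u within S)"
      "(x' has_vector_derivative x'' u) (at u within S)"
      "(x'' has_vector_derivative x''' u) (at u within S)"
      using d1[OF u'] d2[OF u'] d3[OF u'] S by (blast intro: has_vector_derivative_within_subset)+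
    show "norm (x''' u) \<le> B" using b3[OF u'] .
    show "\<bar>u - t\<bar> \<le> h" using u by (auto simp: S_def)
  qed (use that h in \<open>auto simp: S_def\<close>)
  define r1 where "r1 = x (t + h) - x t - h *\<^sub>R x' t - (h\<^sup>2 / 2) *\<^sub>R x'' t"
  define r2 where "r2 = x (t - h) - x t + h *\<^sub>R x' t - (h\<^sup>2 / 2) *\<^sub>R x'' t"
  have r1: "norm r1 \<le> B * h ^ 3" using taylor[of "t + h"] h by (simp add: r1_def S_def)
  have r2: "norm r2 \<le> B * h ^ 3" using taylor[of "t - h"] h by (simp add: r2_def S_def)
  have "norm p \<le> B * \<bar>t - (t - h)\<bar>"
    unfolding p by (rule vector_mean_value_bound[OF _ d1 b1]) (use t h in auto)
  then have np: "norm p \<le> B * h" using h by simp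
  have "norm (G (x t + c *\<^sub>R p) - G (x t)) \<le> L * (\<bar>c\<bar> * norm p)"
    using lipschitz_on_normD[OF lip, of "x t + c *\<^sub>R p" "x t"] by simp
  also have "\<dots> \<le> L * (2 * (B * h))"
    using c np L by (intro mult_left_mono mult_mono) auto
  finally have g: "norm (G (x t + c *\<^sub>R p) - G (x t)) \<le> L * (2 * (B * h))" .
  have "h\<^sup>2 *\<^sub>R (x'' t + (3 / t) *\<^sub>R x' t + G (x t)) = 0" using ode t by simp
  then have ode': "h\<^sup>2 *\<^sub>R G (x t) = - (h\<^sup>2 *\<^sub>R x'' t) - (3 * h / real m) *\<^sub>R x' t"
    using h mpos by (simp add: t_def scaleR_add_right power2_eq_square add_eq_0_iff algebra_simps)
  have p_eq: "p = h *\<^sub>R x' t - (h\<^sup>2 / 2) *\<^sub>R x'' t - r2" by (simp add: p r2_def)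
  have q_eq: "q = h *\<^sub>R x' t + (h\<^sup>2 / 2) *\<^sub>R x'' t + r1" by (simp add: q_def r1_def)
  have c_eq: "c = 1 - 3 / real m" using mpos by (simp add: c_def field_simps)
  \<comment> \<open>Both multiples of \<open>x'' t\<close> that occur become multiples of
    \<open>v\<close>, so that the next identity is linear in \<open>v\<close>, \<open>x' t\<close>,
    \<open>r1\<close> and \<open>r2\<close>.\<close>
  define v where "v = (h\<^sup>2 / 2) *\<^sub>R x'' t"
  have v: "h\<^sup>2 *\<^sub>R x'' t = v + v" "(3 * h\<^sup>2 / (2 * real m)) *\<^sub>R x'' t = (3 / real m) *\<^sub>R v"
    unfolding v_def scaleR_add_left[symmetric] scaleR_scaleR by (simp_all add: field_simps)
  \<comment> \<open>All terms in \<open>x' t\<close> cancel. The term in \<open>x'' t\<close> that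
    survives has order \<open>h^2 / m\<close> and stems from \<open>p\<close> being a one-sided
    difference.\<close>
  have "q - c *\<^sub>R p + h\<^sup>2 *\<^sub>R G (x t)
      = r1 + r2 - (3 / real m) *\<^sub>R r2 - (3 * h\<^sup>2 / (2 * real m)) *\<^sub>R x'' t"
    unfolding ode' v p_eq q_eq c_eq v_def[symmetric] by (simp add: algebra_simps)
  then have eq: "q - c *\<^sub>R p + h\<^sup>2 *\<^sub>R G (x t + c *\<^sub>R p)
      = r1 + r2 - (3 / real m) *\<^sub>R r2 - (3 * h\<^sup>2 / (2 * real m)) *\<^sub>R x'' t
        + h\<^sup>2 *\<^sub>R (G (x t + c *\<^sub>R p) - G (x t))"
    by (simp add: algebra_simps)
  have n3: "norm ((3 / real m) *\<^sub>R r2) \<le> 3 * (B * h ^ 3)"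
  proof -
    have "norm ((3 / real m) *\<^sub>R r2) = (3 / real m) * norm r2" by simp
    also have "\<dots> \<le> 3 * (B * h ^ 3)"
      using m r2 by (intro mult_mono) (auto simp: field_simps)
    finally show ?thesis .
  qed
  have n4: "norm ((3 * h\<^sup>2 / (2 * real m)) *\<^sub>R x'' t) \<le> 2 * h\<^sup>2 / real m * B"
  proof -
    have "norm ((3 * h\<^sup>2 / (2 * real m)) *\<^sub>R x'' t) = (3 * h\<^sup>2 / (2 * real m)) * norm (x'' t)"
      by simp
    also have "\<dots> \<le> 2 * h\<^sup>2 / real m * B"
      using b2[of t] t h mpos by (intro mult_mono) (auto simp: field_simps)
    finally show ?thesis .
  qed
  have n5: "norm (h\<^sup>2 *\<^sub>R (G (x t + c *\<^sub>R p) - G (x t))) \<le> 2 * L * (B * h ^ 3)"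
  proof -
    have "norm (h\<^sup>2 *\<^sub>R (G (x t + c *\<^sub>R p) - G (x t))) = h\<^sup>2 * norm (G (x t + c *\<^sub>R p) - G (x t))"
      by simp
    also have "\<dots> \<le> h\<^sup>2 * (L * (2 * (B * h)))"
      using g by (intro mult_left_mono) auto
    finally show ?thesis by (simp add: power2_eq_square power3_eq_cube algebra_simps)
  qed
  \<comment> \<open>Since \<open>m h = t\<close> is at most \<open>T\<close>, a factor
    \<open>h\<close> can be traded for \<open>T / m\<close>, which brings the cubic terms to the
    form \<open>h^2 / m\<close>.\<close>
  have h3: "B * h ^ 3 \<le> B * (T * h\<^sup>2 / real m)"
  proof (intro mult_left_mono B)
    have "h ^ 3 = t * h\<^sup>2 / real m"
      using mpos by (simp add: t_def power2_eq_square power3_eq_cube)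
    also have "\<dots> \<le> T * h\<^sup>2 / real m"
      using t h mpos by (intro divide_right_mono mult_right_mono) auto
    finally show "h ^ 3 \<le> T * h\<^sup>2 / real m" .
  qed
  have triangle: "norm (v1 + v2 - v3 - v4 + v5) \<le> norm v1 + norm v2 + norm v3 + norm v4 + norm v5"
    for v1 v2 v3 v4 v5 :: 'a
    by norm
  have "norm (q - c *\<^sub>R p + h\<^sup>2 *\<^sub>R G (x t + c *\<^sub>R p))
      \<le> norm r1 + norm r2 + norm ((3 / real m) *\<^sub>R r2) + norm ((3 * h\<^sup>2 / (2 * real m)) *\<^sub>R x'' t)
        + norm (h\<^sup>2 *\<^sub>R (G (x t + c *\<^sub>R p) - G (x t)))"
    unfolding eq by (rule triangle)
  also have "\<dots> \<le> (5 + 2 * L) * (B * h ^ 3) + 2 * h\<^sup>2 / real m * B"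
    using r1 r2 n3 n4 n5 by (simp add: algebra_simps)
  also have "\<dots> \<le> (5 + 2 * L) * (B * (T * h\<^sup>2 / real m)) + 2 * h\<^sup>2 / real m * B"
    using mult_left_mono[OF h3, of "5 + 2 * L"] L by simp
  also have "\<dots> = B * (2 * L * T + 5 * T + 2) * h\<^sup>2 / real m"
    by (simp add: algebra_simps add_divide_distrib)
  finally have "norm (q - c *\<^sub>R p + h\<^sup>2 *\<^sub>R G (x t + c *\<^sub>R p))
    \<le> B * (2 * L * T + 5 * T + 2) * h\<^sup>2 / real m" .
  moreover have "real (Suc m) * h = t + h" by (simp add: t_def algebra_simps)
  ultimately show ?thesis
    by (simp only: q_def c_def t_def)
qed

section \<open>Stability: from residuals to errors\<close>

text \<open>Summing residuals of size \<open>K h^2 / m\<close> into the increments would produce a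
  logarithm. It is avoided because the damping shrinks the old increment by at least the fraction
  \<open>1/m\<close> from \<open>m = 2\<close> on, which makes room for the new residual.\<close>

lemma nag_stability:
  fixes G :: "'a::real_normed_vector \<Rightarrow> 'a" and X :: "nat \<Rightarrow> 'a"
  assumes lip: "L-lipschitz_on UNIV G"
    and h: "h > 0" and K: "K \<ge> 0"
    and res: "\<And>m. m \<ge> 1 \<Longrightarrow> real (Suc m) * h \<le> T \<Longrightarrow>
      norm (X (Suc m) - X m - ((real m - 3) / real m) *\<^sub>R (X m - X (m - 1))
        + h\<^sup>2 *\<^sub>R G (X m + ((real m - 3) / real m) *\<^sub>R (X m - X (m - 1)))) \<le> K * h\<^sup>2 / real m"
    and le: "real n * h \<le> T"
  shows "norm (nag G h (X 0) (X 1) n - X n) \<le> T * K * exp (5 * L * T\<^sup>2) * h"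
proof -
  define y where "y = nag G h (X 0) (X 1)"
  define e where "e k = y k - X k" for k
  \<comment> \<open>The 5 is \<open>1 + 2 * 2\<close>: the extrapolated error is at most
    \<open>M\<close> plus \<open>\<bar>c\<bar> \<le> 2\<close> times an increment of norm at most
    \<open>2 M\<close>. The majorant \<open>M\<close> below is chosen to satisfy the Gronwall
    recursion \<open>M_step\<close>.\<close>
  define a where "a = 5 * L * T * h"
  define M where "M k = real k * (K * h\<^sup>2) * (1 + a) ^ k" for k
  have T: "0 \<le> T" using le h by (meson mult_nonneg_nonneg of_nat_0_le_iff less_imp_le order_trans)
  have L: "0 \<le> L" using lip by (rule lipschitz_on_nonneg)
  have a: "0 \<le> a" using L T h by (simp add: a_def)
  have e01: "e 0 = 0" "e (Suc 0) = 0" by (simp_all add: e_def y_def)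
  have M_nonneg: "0 \<le> M k" for k using K a by (simp add: M_def)
  have M_step: "(1 + a) * M k + K * h\<^sup>2 \<le> M (Suc k)" for k
  proof -
    have "1 \<le> (1 + a) ^ Suc k" using a by (intro one_le_power) simp
    then have "K * h\<^sup>2 * 1 \<le> K * h\<^sup>2 * (1 + a) ^ Suc k" using K by (intro mult_left_mono) auto
    then show ?thesis by (simp add: M_def algebra_simps)
  qed
  have M_mono: "M k \<le> M (Suc k)" for k
  proof -
    have "0 \<le> a * M k" "0 \<le> K * h\<^sup>2" using a M_nonneg[of k] K by auto
    then show ?thesis using M_step[of k] by (simp add: algebra_simps)
  qed
  \<comment> \<open>The recursion has two steps, so the induction carries two consecutive errors
    together with the increment between them.\<close>
  have claim: "norm (e k) \<le> M k \<and> norm (e (Suc k)) \<le> M (Suc k) \<and>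
      norm (e (Suc k) - e k) \<le> K * h\<^sup>2 + a * M k" if "real (Suc k) * h \<le> T" for k
    using that
  proof (induction k)
    case 0
    then show ?case using M_nonneg[of 0] M_nonneg[of 1] K a by (simp add: e01)
  next
    case (Suc k)
    define m where "m = Suc k"
    define c where "c = (real m - 3) / real m"
    define D where "D = K * h\<^sup>2 + a * M m"
    have "real (Suc k) * h \<le> real (Suc (Suc k)) * h"
      using h by (intro mult_right_mono) auto
    with Suc.prems have mT: "real m * h \<le> T" unfolding m_def by linarith
    with Suc.IH have IH: "norm (e k) \<le> M k" "norm (e m) \<le> M m"
      "norm (e m - e k) \<le> K * h\<^sup>2 + a * M k" by (auto simp: m_def)
    have mpos: "real m > 0" by (simp add: m_def)
    have ek: "norm (e k) \<le> M m" using IH(1) M_mono[of k] by (simp add: m_def)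
    have D: "0 \<le> D" "norm (e m - e k) \<le> D"
      using IH(3) K a M_nonneg[of m] mult_left_mono[OF M_mono[of k] a] by (auto simp: D_def m_def)
    define u where "u = y m + c *\<^sub>R (y m - y k)"
    define U where "U = X m + c *\<^sub>R (X m - X k)"
    define r where "r = X (Suc m) - X m - c *\<^sub>R (X m - X k) + h\<^sup>2 *\<^sub>R G U"
    have r: "norm r \<le> K * h\<^sup>2 / real m"
      using res[of m] Suc.prems by (simp add: r_def U_def c_def m_def)
    have ym: "y (Suc m) = u - h\<^sup>2 *\<^sub>R G u"
      by (simp add: y_def u_def c_def m_def Let_def)
    have c2: "\<bar>c\<bar> \<le> 2" by (auto simp: c_def m_def field_simps abs_le_iff)
    have "e (Suc m) - e m = c *\<^sub>R (e m - e k) - h\<^sup>2 *\<^sub>R (G u - G U) - r"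
      by (simp add: e_def ym r_def algebra_simps) (simp add: u_def U_def algebra_simps)
    then have "norm (e (Suc m) - e m)
        \<le> norm (c *\<^sub>R (e m - e k)) + norm (h\<^sup>2 *\<^sub>R (G u - G U)) + norm r"
      using norm_triangle_ineq4[of "c *\<^sub>R (e m - e k)" "h\<^sup>2 *\<^sub>R (G u - G U)"]
        norm_triangle_ineq4[of "c *\<^sub>R (e m - e k) - h\<^sup>2 *\<^sub>R (G u - G U)" r]
      by simp
    also have "norm (h\<^sup>2 *\<^sub>R (G u - G U)) \<le> a * M m / real m"
    proof -
      have uU: "u - U = e m + c *\<^sub>R (e m - e k)" by (simp add: u_def U_def e_def algebra_simps)
      have "norm (e m - e k) \<le> 2 * M m" using norm_triangle_ineq4[of "e m" "e k"] IH(2) ek by simp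
      then have "\<bar>c\<bar> * norm (e m - e k) \<le> 2 * (2 * M m)" using c2 by (intro mult_mono) auto
      then have "norm (u - U) \<le> 5 * M m"
        using norm_triangle_ineq[of "e m" "c *\<^sub>R (e m - e k)"] IH(2) uU by simp
      then have "norm (G u - G U) \<le> L * (5 * M m)"
        using lipschitz_on_normD[OF lip, of u U] mult_left_mono[OF _ L] by fastforce
      then have "norm (h\<^sup>2 *\<^sub>R (G u - G U)) \<le> h\<^sup>2 * (L * (5 * M m))"
        by (simp add: mult_left_mono)
      \<comment> \<open>One factor \<open>h\<close> is again traded for \<open>T / m\<close>, so
        that the gradient term can be absorbed by the damping just like the residual.\<close>
      also have "\<dots> = (5 * L * h * M m) * (real m * h) / real m"
        using mpos by (simp add: power2_eq_square)
      also have "\<dots> \<le> (5 * L * h * M m) * T / real m"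
        using mT mpos L h M_nonneg[of m] by (intro divide_right_mono mult_left_mono) auto
      finally show ?thesis by (simp add: a_def algebra_simps)
    qed
    also note r
    finally have "norm (e (Suc m) - e m) \<le> \<bar>c\<bar> * norm (e m - e k) + D / real m"
      by (simp add: D_def add_divide_distrib)
    also have "\<dots> \<le> D"
    \<comment> \<open>At \<open>m = 1\<close> the coefficient is -2 and damping fails, but the old
      increment is zero and \<open>D / m = D\<close>. At \<open>m = 2\<close> the sum
      \<open>\<bar>c\<bar> + 1/m\<close> is exactly 1; from \<open>m = 3\<close> on it equals
      \<open>1 - 2/m\<close>.\<close>
    proof (cases "k = 0")
      case True
      then show ?thesis by (simp add: m_def e01)
    next
      case False
      then have "\<bar>c\<bar> + 1 / real m \<le> 1"
        by (cases "k = 1") (auto simp: c_def m_def field_simps abs_if)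
      then have "D * (\<bar>c\<bar> + 1 / real m) \<le> D * 1" using D by (intro mult_left_mono) auto
      moreover have "\<bar>c\<bar> * norm (e m - e k) \<le> \<bar>c\<bar> * D" using D by (intro mult_left_mono) auto
      ultimately show ?thesis by (simp add: algebra_simps)
    qed
    finally have d: "norm (e (Suc m) - e m) \<le> D" .
    have "norm (e (Suc m)) \<le> M m + D"
      using norm_triangle_ineq[of "e m" "e (Suc m) - e m"] d IH(2) by simp
    then have "norm (e (Suc m)) \<le> M (Suc m)"
      using M_step[of m] by (simp add: D_def algebra_simps)
    then show ?case using IH d by (simp add: m_def D_def)
  qed
  have "norm (e n) \<le> M n"
    \<comment> \<open>The claim at \<open>k\<close> reaches index \<open>k + 1\<close>, hence the
      shift; \<open>n = 0\<close> is treated apart because \<open>e 0 = 0\<close>.\<close>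
    using claim[of "n - 1"] le by (cases n) (auto simp: e01 M_nonneg)
  also have "\<dots> = (real n * h) * (K * h) * (1 + a) ^ n"
    by (simp add: M_def power2_eq_square)
  also have "\<dots> \<le> T * (K * h) * exp (5 * L * T\<^sup>2)"
  proof (intro mult_mono)
    \<comment> \<open>The growth factor stays bounded uniformly in \<open>h\<close>, because
      \<open>n a = 5 L T (n h)\<close> with \<open>n h\<close> at most \<open>T\<close>.\<close>
    have "(1 + a) ^ n \<le> exp a ^ n" using a by (intro power_mono) auto
    also have "\<dots> = exp (5 * L * T * (real n * h))"
      by (simp add: a_def mult.assoc mult.left_commute flip: exp_of_nat_mult)
    also have "\<dots> \<le> exp (5 * L * T * T)"
      using le L T by (simp add: mult_left_mono)
    finally show "(1 + a) ^ n \<le> exp (5 * L * T\<^sup>2)" by (simp add: power2_eq_square mult.assoc)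
  qed (use le T K h a in auto)
  finally show ?thesis by (simp add: e_def y_def algebra_simps)
qed

section \<open>Convergence at a fixed time\<close>

lemma continuous_on_norm_bound:
  fixes f :: "real \<Rightarrow> 'a::real_normed_vector"
  assumes "continuous_on {a..b} f"
  obtains B where "\<And>u. u \<in> {a..b} \<Longrightarrow> norm (f u) \<le> B"
  using compact_imp_bounded[OF compact_continuous_image[OF assms compact_Icc]]
  unfolding bounded_iff by blast

theorem theorem2:
  fixes F :: "real ^ 'd \<Rightarrow> real"
    and gradF :: "real ^ 'd \<Rightarrow> real ^ 'd"
    and L :: real
    and x x' x'' x''' :: "real \<Rightarrow> real ^ 'd"
  assumes gradient: "\<And>z. GDERIV F z :> gradF z"
    and lipschitz: "L-lipschitz_on UNIV gradF"
    and deriv1: "\<And>t. t \<ge> 0 \<Longrightarrow> (x has_vector_derivative x' t) (at t within {0..})"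
    and deriv2: "\<And>t. t \<ge> 0 \<Longrightarrow> (x' has_vector_derivative x'' t) (at t within {0..})"
    and deriv3: "\<And>t. t \<ge> 0 \<Longrightarrow> (x'' has_vector_derivative x''' t) (at t within {0..})"
    and cont3: "continuous_on {0..} x'''"
    and ode: "\<And>t. t > 0 \<Longrightarrow> x'' t + (3 / t) *\<^sub>R x' t + gradF (x t) = 0"
  shows "\<forall>t>0. \<exists>C>0. \<exists>h0\<in>{0<..<1}. \<forall>h\<in>{0<..<h0}. \<forall>n::nat.
           t / h = real n \<longrightarrow>
           norm (nag gradF h (x 0) (x h) n - x t) \<le> C * h * ln (1 / h)"
proof (intro allI impI)
  \<comment> \<open>The fixed time serves as the horizon: all sample points up to index
    \<open>n\<close> lie in the compact interval \<open>{0..T}\<close>, on which the three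
    derivatives are bounded.\<close>
  fix T :: real
  assume T: "T > 0"
  have d: "(x has_vector_derivative x' u) (at u within {0..T})"
    "(x' has_vector_derivative x'' u) (at u within {0..T})"
    "(x'' has_vector_derivative x''' u) (at u within {0..T})" if "u \<in> {0..T}" for u
    using deriv1[of u] deriv2[of u] deriv3[of u] that
    by (auto intro: has_vector_derivative_within_subset[where S = "{0..}"])
  have "continuous_on {0..T} x'"
    using has_vector_derivative_continuous[OF d(2)] by (simp add: continuous_on_eq_continuous_within)
  then obtain B1 where B1: "\<And>u. u \<in> {0..T} \<Longrightarrow> norm (x' u) \<le> B1"
    by (rule continuous_on_norm_bound) blast
  have "continuous_on {0..T} x''"
    using has_vector_derivative_continuous[OF d(3)] by (simp add: continuous_on_eq_continuous_within)
  then obtain B2 where B2: "\<And>u. u \<in> {0..T} \<Longrightarrow> norm (x'' u) \<le> B2"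
    by (rule continuous_on_norm_bound) blast
  have "continuous_on {0..T} x'''"
    using cont3 by (rule continuous_on_subset) auto
  then obtain B3 where B3: "\<And>u. u \<in> {0..T} \<Longrightarrow> norm (x''' u) \<le> B3"
    by (rule continuous_on_norm_bound) blast
  \<comment> \<open>The 1 in the maximum keeps \<open>B\<close>, and with it \<open>K\<close> and
    \<open>C\<close>, strictly positive even for a constant solution.\<close>
  define B where "B = max 1 (max B1 (max B2 B3))"
  have b: "norm (x' u) \<le> B" "norm (x'' u) \<le> B" "norm (x''' u) \<le> B" if "u \<in> {0..T}" for u
    using B1[OF that] B2[OF that] B3[OF that] by (auto simp: B_def)
  have L: "0 \<le> L" using lipschitz by (rule lipschitz_on_nonneg)
  define K where "K = B * (2 * L * T + 5 * T + 2)"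
  have "0 \<le> L * T" using L T by simp
  then have K: "K > 0" using T by (auto simp: K_def B_def intro!: mult_pos_pos)
  define C where "C = T * K * exp (5 * L * T\<^sup>2)"
  have C: "C > 0" using T K by (simp add: C_def)
  \<comment> \<open>The threshold \<open>exp (- 1)\<close> lies in the open unit interval and forces
    \<open>ln (1 / h)\<close> to be at least 1, so the bound \<open>C * h\<close> implies the stated
    one.\<close>
  have "norm (nag gradF h (x 0) (x h) n - x T) \<le> C * h * ln (1 / h)"
    if h: "h \<in> {0<..<exp (- 1)}" and n: "T / h = real n" for h n
  proof -
    have hpos: "h > 0" using h by simp
    have nh: "real n * h = T" using n hpos by (simp add: field_simps)
    \<comment> \<open>The starting values are written as samples at indices 0 and 1 to match the
      sequence \<open>X\<close> of the stability bound.\<close>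
    have "norm (nag gradF h (x (real 0 * h)) (x (real 1 * h)) n - x (real n * h)) \<le> C * h"
      unfolding C_def
    proof (rule nag_stability[OF lipschitz hpos, where X = "\<lambda>k. x (real k * h)"])
      show "norm (x (real (Suc m) * h) - x (real m * h)
            - ((real m - 3) / real m) *\<^sub>R (x (real m * h) - x (real (m - 1) * h))
            + h\<^sup>2 *\<^sub>R gradF (x (real m * h)
                + ((real m - 3) / real m) *\<^sub>R (x (real m * h) - x (real (m - 1) * h))))
          \<le> K * h\<^sup>2 / real m" if "1 \<le> m" "real (Suc m) * h \<le> T" for m
        unfolding K_def
        by (rule nag_residual_bound[OF lipschitz d b ode hpos that])
    qed (use K nh in auto)
    then have "norm (nag gradF h (x 0) (x h) n - x T) \<le> C * h * 1" by (simp add: nh)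
    also have "\<dots> \<le> C * h * ln (1 / h)"
    proof (intro mult_left_mono)
      have "ln h \<le> ln (exp (- 1))" using h by (subst ln_le_cancel_iff) auto
      then show "1 \<le> ln (1 / h)" using hpos by (simp add: ln_div)
    qed (use C hpos in auto)
    finally show ?thesis .
  qed
  then show "\<exists>C>0. \<exists>h0\<in>{0<..<1}. \<forall>h\<in>{0<..<h0}. \<forall>n::nat. T / h = real n \<longrightarrow>
      norm (nag gradF h (x 0) (x h) n - x T) \<le> C * h * ln (1 / h)"
    using C by (intro exI[of _ C] conjI bexI[of _ "exp (- 1)"]) auto
qed

end
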